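(* Let $(X,b)$ be a connected weighted graph with $X$ infinite and $\mathcal F_c(X)\subset\mathcal D$, and assume that there is $c>0$ with $\|f\|_\infty^2\le c\,\mathcal E(f)$ for all $f\in\mathcal F_c(X)$. Let $c_P^0$ be the smallest constant $c$ for which this inequality holds for all $f\in\mathcal F_c(X)$. Then $$\frac1{c_P^0}=\inf_m\{\text{lowest eigenvalue of }H_m^{(D)}\},$$ where the infimum is taken over all probability measures $m$ on $X$ of full support.
   Context: A weighted graph $(X,b)$ consists of a countable set $X$ and a symmetric function $b:X\times X\to[0,\infty)$ with $b(x,x)=0$ for all $x\in X$. It is connected if for any $x,y\in X$ there are $x=x_0,x_1,\dots,x_k=y$ with $b(x_j,x_{j+1})>0$ for $0\le j<k$. $\mathcal F_c(X)$ is the space of finitely supported real functions on $X$. Let $\mathcal D=\{f:X\to\mathbb R\mid \sum_{x,y\in X}b(x,y)|f(x)-f(y)|^2<\infty\}$ and $\mathcal E(f,g)=\frac12\sum_{x,y\in X}b(x,y)(f(x)-f(y))(g(x)-g(y))$, $\mathcal E(f)=\mathcal E(f,f)$. $\|f\|_\infty=\sup_{x\in X}|f(x)|$. A measure $m$ on $X$ has full support if $m(x):=m(\{x\})>0$ for all $x$; $\ell^2(X,m)=\{f:X\to\mathbb R\mid\|f\|_2^2=\sum_x|f(x)|^2m(x)<\infty\}$. $\mathcal E^{(D)}$ is the closed form on $\ell^2(X,m)$ obtained by restricting $\mathcal E$ to the closure of $\mathcal F_c(X)$ in $\mathcal D\cap\ell^2(X,m)$ with respect to the form norm $(\mathcal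 E(f)+\|f\|_2^2)^{1/2}$; $H_m^{(D)}$ is the associated nonnegative selfadjoint operator on $\ell^2(X,m)$. Under the assumed inequality and for a probability measure $m$, the spectrum of $H_m^{(D)}$ consists of eigenvalues which can be listed in increasing order. *)

theory Defs
  imports "HOL-Probability.Probability_Measure"
begin

text \<open>
  The vertex set \<open>X\<close> is the universe of the type \<^typ>\<open>'a\<close>, so that functions \<open>X \<rightarrow> \<real>\<close> are
  exactly the elements of \<^typ>\<open>'a \<Rightarrow> real\<close>.  Sums over \<open>X\<close> and \<open>X \<times> X\<close> are unordered sums;
  for nonnegative terms \<open>summable_on\<close> says precisely that the sum is finite.
\<close>

definition weighted_graph :: "('a \<Rightarrow> 'a \<Rightarrow> real) \<Rightarrow> bool" where
  "weighted_graph b \<longleftrightarrow>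
     countable (UNIV :: 'a set) \<and>
     (\<forall>x y. 0 \<le> b x y) \<and> (\<forall>x y. b x y = b y x) \<and> (\<forall>x. b x x = 0)"

definition connected_graph :: "('a \<Rightarrow> 'a \<Rightarrow> real) \<Rightarrow> bool" where
  "connected_graph b \<longleftrightarrow>
     (\<forall>x y. \<exists>(k::nat) p. p 0 = x \<and> p k = y \<and> (\<forall>j<k. 0 < b (p j) (p (Suc j))))"

definition fin_supp :: "('a \<Rightarrow> real) set" where
  "fin_supp = {f. finite {x. f x \<noteq> 0}}"

definition finite_energy :: "('a \<Rightarrow> 'a \<Rightarrow> real) \<Rightarrow> ('a \<Rightarrow> real) set" where
  "finite_energy b = {f. (\<lambda>(x, y). b x y * \<bar>f x - f y\<bar>\<^sup>2) summable_on UNIV}"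

definition energy :: "('a \<Rightarrow> 'a \<Rightarrow> real) \<Rightarrow> ('a \<Rightarrow> real) \<Rightarrow> ('a \<Rightarrow> real) \<Rightarrow> real" where
  "energy b f g = 1/2 * (\<Sum>\<^sub>\<infinity>(x, y)\<in>UNIV. b x y * (f x - f y) * (g x - g y))"

definition sup_norm :: "('a \<Rightarrow> real) \<Rightarrow> real" where
  "sup_norm f = (SUP x. \<bar>f x\<bar>)"

definition sup_poincare :: "('a \<Rightarrow> 'a \<Rightarrow> real) \<Rightarrow> real \<Rightarrow> bool" where
  "sup_poincare b c \<longleftrightarrow> (\<forall>f\<in>fin_supp. (sup_norm f)\<^sup>2 \<le> c * energy b f f)"

definition poincare_const :: "('a \<Rightarrow> 'a \<Rightarrow> real) \<Rightarrow> real" where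
  "poincare_const b = (LEAST c. sup_poincare b c)"

definition full_support_prob :: "'a measure set" where
  "full_support_prob = {m. prob_space m \<and> sets m = UNIV \<and> (\<forall>x. 0 < measure m {x})}"

text \<open>
  The weight \<open>m(x)\<close> is \<^term>\<open>measure m {x}\<close>.  As all weights are positive for \<open>m\<close> of full support,
  no passage to almost-everywhere classes is needed in \<open>\<ell>\<^sup>2(X,m)\<close>.
\<close>

definition ell2 :: "'a measure \<Rightarrow> ('a \<Rightarrow> real) set" where
  "ell2 m = {f. (\<lambda>x. \<bar>f x\<bar>\<^sup>2 * measure m {x}) summable_on UNIV}"

definition ell2_inner :: "'a measure \<Rightarrow> ('a \<Rightarrow> real) \<Rightarrow> ('a \<Rightarrow> real) \<Rightarrow> real" where
  "ell2_inner m f g = (\<Sum>\<^sub>\<infinity>x\<in>UNIV. f x * g x * measure m {x})"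

definition form_norm :: "('a \<Rightarrow> 'a \<Rightarrow> real) \<Rightarrow> 'a measure \<Rightarrow> ('a \<Rightarrow> real) \<Rightarrow> real" where
  "form_norm b m f = sqrt (energy b f f + ell2_inner m f f)"

definition form_dom :: "('a \<Rightarrow> 'a \<Rightarrow> real) \<Rightarrow> 'a measure \<Rightarrow> ('a \<Rightarrow> real) set" where
  "form_dom b m =
     {f \<in> finite_energy b \<inter> ell2 m.
        \<forall>\<epsilon>>0. \<exists>g\<in>fin_supp. form_norm b m (\<lambda>x. f x - g x) < \<epsilon>}"

text \<open>
  The selfadjoint operator associated with the closed form \<open>energy b\<close> on \<open>form_dom b m\<close>, as in the
  first representation theorem for forms: \<open>f\<close> is in its domain iff \<open>\<E>(f,h) = \<langle>g,h\<rangle>\<close> for all \<open>h\<close>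
  in the form domain and some \<open>g \<in> \<ell>\<^sup>2(X,m)\<close>, and then \<open>g\<close> is its value at \<open>f\<close>.  This \<open>g\<close> is unique
  since the form domain is dense.
\<close>

definition represents :: "('a \<Rightarrow> 'a \<Rightarrow> real) \<Rightarrow> 'a measure \<Rightarrow> ('a \<Rightarrow> real) \<Rightarrow> ('a \<Rightarrow> real) \<Rightarrow> bool" where
  "represents b m f g \<longleftrightarrow>
     g \<in> ell2 m \<and> (\<forall>h\<in>form_dom b m. energy b f h = ell2_inner m g h)"

definition laplacian_dom :: "('a \<Rightarrow> 'a \<Rightarrow> real) \<Rightarrow> 'a measure \<Rightarrow> ('a \<Rightarrow> real) set" where
  "laplacian_dom b m = {f \<in> form_dom b m. \<exists>g. represents b m f g}"

definition laplacian :: "('a \<Rightarrow> 'a \<Rightarrow> real) \<Rightarrow> 'a measure \<Rightarrow> ('a \<Rightarrow> real) \<Rightarrow> 'a \<Rightarrow> real" where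
  "laplacian b m f = (THE g. represents b m f g)"

definition laplacian_eigenvalue :: "('a \<Rightarrow> 'a \<Rightarrow> real) \<Rightarrow> 'a measure \<Rightarrow> real \<Rightarrow> bool" where
  "laplacian_eigenvalue b m l \<longleftrightarrow>
     (\<exists>f\<in>laplacian_dom b m. f \<noteq> (\<lambda>x. 0) \<and> laplacian b m f = (\<lambda>x. l * f x))"

definition lowest_eigenvalue :: "('a \<Rightarrow> 'a \<Rightarrow> real) \<Rightarrow> 'a measure \<Rightarrow> real" where
  "lowest_eigenvalue b m = (LEAST l. laplacian_eigenvalue b m l)"

end

theory Submission
  imports Defs "HOL-Probability.Probability_Mass_Function" "HOL-Complex_Analysis.Great_Picard"
begin

text \<open>
  If \<open>\<parallel>f\<parallel>\<^sub>\<infinity>\<^sup>2 \<le> c \<E>(f)\<close> on finitely supported functions, then \<open>\<parallel>f\<parallel>\<^sub>2\<^sup>2 \<le> c \<E>(f)\<close> for every probability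
  measure, so the infimum of the Rayleigh quotient is at least \<open>1/c\<close>.  This infimum is the lowest
  eigenvalue: a normalised minimising sequence is uniformly bounded, so a subsequence converges
  pointwise and, by dominated convergence, in \<open>\<ell>\<^sup>2\<close>; the parallelogram identity makes it Cauchy for the
  energy, and the limit satisfies the Euler--Lagrange equation.  Conversely, if \<open>f\<close> nearly attains
  the best constant at a vertex \<open>x\<close>, a measure of full support with almost all its mass at \<open>x\<close> makes
  the Rayleigh quotient of \<open>f\<close> almost equal to \<open>1/c\<close>.
\<close>

subsection \<open>Weighted sums of squares\<close>

text \<open>The minimum over t is attained at t = -b/c once c > 0; that c is not negative is a
  consequence of the hypothesis. The case a = 0 later forces the first variation of a minimiser to
  vanish.\<close>

lemma discriminant_le_if_nonneg:
  fixes a b c :: real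
  assumes nonneg: "\<And>t. 0 \<le> a + 2 * t * b + t\<^sup>2 * c"
  shows "b\<^sup>2 \<le> a * c"
proof (cases "c = 0")
  case True
  have "b = 0"
  proof (rule ccontr)
    assume "b \<noteq> 0"
    then show False
      using nonneg[of "- (a + 1) / (2 * b)"] True by (simp add: field_simps)
  qed
  then show ?thesis using True by simp
next
  case False
  have "0 \<le> c"
  proof (rule ccontr)
    assume "\<not> 0 \<le> c"
    then have c: "c < 0" by simp
    \<comment> \<open>For negative c the quadratic term wins for large t. The final + 1 gives t >=
      1, so that \<open>t * \<bar>a\<bar>\<close> dominates \<open>\<bar>a\<bar>\<close>.\<close>
    define t where "t = (2 * \<bar>b\<bar> + \<bar>a\<bar> + 1) / (- c) + 1"
    have t: "1 \<le> t" unfolding t_def using c by (simp add: divide_nonneg_neg)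
    have "t * (- c) = 2 * \<bar>b\<bar> + \<bar>a\<bar> + 1 - c" unfolding t_def using c by (simp add: field_simps)
    then have "t * c < - 2 * \<bar>b\<bar> - \<bar>a\<bar>" using c by simp
    then have "t * (t * c) < t * (- 2 * \<bar>b\<bar> - \<bar>a\<bar>)" using t by simp
    moreover have "1 * \<bar>a\<bar> \<le> t * \<bar>a\<bar>" using t by (intro mult_right_mono) auto
    moreover have "t * b \<le> t * \<bar>b\<bar>" using t by simp
    ultimately have "a + 2 * (t * b) + t * (t * c) < 0"
      by (simp add: algebra_simps)
    then show False using nonneg[of t] by (simp add: power2_eq_square algebra_simps)
  qed
  then have "0 < c" using False by simp
  have "0 \<le> (a + 2 * (- b / c) * b + (- b / c)\<^sup>2 * c) * c"
    using nonneg[of "- b / c"] \<open>0 < c\<close> by simp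
  also have "\<dots> = a * c - b\<^sup>2"
    using \<open>0 < c\<close> by (simp add: field_simps power2_eq_square)
  finally show ?thesis by simp
qed

text \<open>
  Energy and \<open>\<ell>\<^sup>2\<close>-norm are both weighted sums of squares of linear functionals that are
  continuous for pointwise convergence.
\<close>

locale square_sum_form =
  fixes w :: "'i \<Rightarrow> real" and T :: "'i \<Rightarrow> ('a \<Rightarrow> real) \<Rightarrow> real"
  assumes w_nonneg: "0 \<le> w i"
    and T_linear: "T i (\<lambda>x. f x + t * g x) = T i f + t * T i g"
    and T_tendsto: "(\<And>x. (\<lambda>n. F n x) \<longlonglongrightarrow> f x) \<Longrightarrow> (\<lambda>n::nat. T i (F n)) \<longlonglongrightarrow> T i f"
begin

definition dom :: "('a \<Rightarrow> real) set" where
  "dom = {f. (\<lambda>i. w i * (T i f)\<^sup>2) summable_on UNIV}"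

text \<open>A non-summable family has \<open>infsum\<close> 0. Hence positivity and scaling hold for
  all functions, whereas additivity is proved only on \<open>dom\<close>.\<close>

definition ip :: "('a \<Rightarrow> real) \<Rightarrow> ('a \<Rightarrow> real) \<Rightarrow> real" where
  "ip f g = (\<Sum>\<^sub>\<infinity>i. w i * T i f * T i g)"

abbreviation qf :: "('a \<Rightarrow> real) \<Rightarrow> real" where
  "qf f \<equiv> ip f f"

lemma T_zero: "T i (\<lambda>x. 0) = 0"
  using T_linear[of i "\<lambda>x. 0" 1 "\<lambda>x. 0"] by simp

lemma T_scale: "T i (\<lambda>x. t * f x) = t * T i f"
  using T_linear[of i "\<lambda>x. 0" t f] by (simp add: T_zero)

lemma T_diff: "T i (\<lambda>x. f x - g x) = T i f - T i g"
  using T_linear[of i f "-1" g] by simp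

lemma qf_eq: "qf f = (\<Sum>\<^sub>\<infinity>i. w i * (T i f)\<^sup>2)"
  by (simp add: ip_def power2_eq_square mult.assoc)

lemma qf_nonneg: "0 \<le> qf f"
  unfolding qf_eq by (intro infsum_nonneg) (simp add: w_nonneg)

lemma ip_commute: "ip f g = ip g f"
  by (simp add: ip_def ac_simps)

lemma ip_scale: "ip (\<lambda>x. t * f x) g = t * ip f g"
  unfolding ip_def T_scale
  by (subst infsum_cmult_right'[symmetric]) (simp add: ac_simps)

lemma qf_scale: "qf (\<lambda>x. t * f x) = t\<^sup>2 * qf f"
proof -
  have "qf (\<lambda>x. t * f x) = t * ip (\<lambda>x. t * f x) f"
    by (subst ip_scale, subst ip_commute, rule refl)
  then show ?thesis by (simp add: ip_scale power2_eq_square)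
qed

lemma ip_summable:
  assumes "f \<in> dom" "g \<in> dom"
  shows "(\<lambda>i. w i * T i f * T i g) summable_on UNIV"
proof (rule abs_summable_summable, rule Infinite_Sum.abs_summable_on_comparison_test')
  show "(\<lambda>i. w i * (T i f)\<^sup>2 + w i * (T i g)\<^sup>2) summable_on UNIV"
    using assms by (intro summable_on_add) (auto simp: dom_def)
next
  fix i
  have "2 * (\<bar>T i f\<bar> * \<bar>T i g\<bar>) \<le> \<bar>T i f\<bar>\<^sup>2 + \<bar>T i g\<bar>\<^sup>2"
    using sum_squares_bound[of "\<bar>T i f\<bar>" "\<bar>T i g\<bar>"] by (simp add: mult.assoc)
  moreover have "0 \<le> \<bar>T i f\<bar> * \<bar>T i g\<bar>" by simp
  ultimately have "\<bar>T i f\<bar> * \<bar>T i g\<bar> \<le> (T i f)\<^sup>2 + (T i g)\<^sup>2"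
    unfolding power2_abs by linarith
  then have "w i * (\<bar>T i f\<bar> * \<bar>T i g\<bar>) \<le> w i * ((T i f)\<^sup>2 + (T i g)\<^sup>2)"
    by (rule mult_left_mono) (rule w_nonneg)
  then show "norm (w i * T i f * T i g) \<le> w i * (T i f)\<^sup>2 + w i * (T i g)\<^sup>2"
    by (simp add: abs_mult w_nonneg algebra_simps)
qed

text \<open>Stated with \<open>has_sum\<close> so that one series gives both the closure of
  \<open>dom\<close> under linear combinations and the quadratic expansion of
  \<open>qf\<close>.\<close>

lemma qf_has_sum_linear:
  assumes "f \<in> dom" "g \<in> dom"
  shows "((\<lambda>i. w i * (T i (\<lambda>x. f x + t * g x))\<^sup>2) has_sum
           (qf f + (2 * t * ip f g + t\<^sup>2 * qf g))) UNIV"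
proof -
  have sum: "((\<lambda>i. w i * T i u * T i v) has_sum ip u v) UNIV" if "u \<in> dom" "v \<in> dom" for u v
    unfolding ip_def using ip_summable[OF that] by simp
  have "((\<lambda>i. w i * T i f * T i f + (2 * t * (w i * T i f * T i g) + t\<^sup>2 * (w i * T i g * T i g)))
          has_sum (qf f + (2 * t * ip f g + t\<^sup>2 * qf g))) UNIV"
    by (intro has_sum_add has_sum_cmult_right sum assms)
  then show ?thesis
    by (simp add: T_linear power2_eq_square algebra_simps)
qed

lemma dom_linear: "f \<in> dom \<Longrightarrow> g \<in> dom \<Longrightarrow> (\<lambda>x. f x + t * g x) \<in> dom"
  unfolding dom_def using qf_has_sum_linear by (auto intro: has_sum_imp_summable simp: dom_def)

lemma qf_linear:
  "f \<in> dom \<Longrightarrow> g \<in> dom \<Longrightarrow> qf (\<lambda>x. f x + t * g x) = qf f + 2 * t * ip f g + t\<^sup>2 * qf g"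
  using infsumI[OF qf_has_sum_linear] by (simp add: qf_eq[of "\<lambda>x. f x + t * g x"])

lemma dom_diff: "f \<in> dom \<Longrightarrow> g \<in> dom \<Longrightarrow> (\<lambda>x. f x - g x) \<in> dom"
  using dom_linear[of f g "-1"] by simp

lemma qf_diff:
  "f \<in> dom \<Longrightarrow> g \<in> dom \<Longrightarrow> qf (\<lambda>x. f x - g x) = qf f - 2 * ip f g + qf g"
  using qf_linear[of f g "-1"] by simp

lemma qf_diff_commute: "qf (\<lambda>x. f x - g x) = qf (\<lambda>x. g x - f x)"
  unfolding qf_eq T_diff by (simp add: power2_commute)

lemma parallelogram:
  "f \<in> dom \<Longrightarrow> g \<in> dom \<Longrightarrow>
     qf (\<lambda>x. f x + g x) + qf (\<lambda>x. f x - g x) = 2 * qf f + 2 * qf g"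
  using qf_linear[of f g 1] qf_diff[of f g] by simp

text \<open>Parallelogram identity for f - h and g - h, with the nonnegative square of their sum
  dropped.\<close>

lemma qf_triangle:
  assumes "f \<in> dom" "g \<in> dom" "h \<in> dom"
  shows "qf (\<lambda>x. f x - g x) \<le> 2 * qf (\<lambda>x. f x - h x) + 2 * qf (\<lambda>x. g x - h x)"
  using parallelogram[OF dom_diff[OF assms(1,3)] dom_diff[OF assms(2,3)]]
    qf_nonneg[of "\<lambda>x. f x - h x + (g x - h x)"] by simp

text \<open>The expansions at t and -t add up to the right-hand side, and both are
  nonnegative.\<close>

lemma qf_linear_le:
  assumes "f \<in> dom" "g \<in> dom"
  shows "qf (\<lambda>x. f x + t * g x) \<le> 2 * qf f + 2 * t\<^sup>2 * qf g"
  using qf_linear[OF assms, of t] qf_linear[OF assms, of "-t"]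
    qf_nonneg[of "\<lambda>x. f x + (-t) * g x"] by simp

lemma cauchy_schwarz:
  assumes "f \<in> dom" "g \<in> dom"
  shows "(ip f g)\<^sup>2 \<le> qf f * qf g"
proof (rule discriminant_le_if_nonneg)
  fix t
  show "0 \<le> qf f + 2 * t * ip f g + t\<^sup>2 * qf g"
    using qf_nonneg[of "\<lambda>x. f x + t * g x"] qf_linear[OF assms] by simp
qed

lemma ip_diff_tendsto_zero:
  assumes "f \<in> dom" "g \<in> dom" "\<And>n. G n \<in> dom"
    and lim: "(\<lambda>n. qf (\<lambda>x. G n x - g x)) \<longlonglongrightarrow> 0"
  shows "(\<lambda>n. ip f (\<lambda>x. G n x - g x)) \<longlonglongrightarrow> 0"
proof -
  have "(\<lambda>n. qf f * qf (\<lambda>x. G n x - g x)) \<longlonglongrightarrow> 0"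
    using tendsto_mult_right_zero[OF lim] by simp
  then have "(\<lambda>n. (ip f (\<lambda>x. G n x - g x))\<^sup>2) \<longlonglongrightarrow> 0"
    by (rule tendsto_sandwich[OF _ _ tendsto_const, rotated 2])
       (auto intro!: always_eventually cauchy_schwarz dom_diff assms)
  then show ?thesis by (simp add: power2_eq_square flip: power2_eq_square)
qed

lemma qf_tendsto:
  assumes "g \<in> dom" "\<And>n. G n \<in> dom"
    and lim: "(\<lambda>n. qf (\<lambda>x. G n x - g x)) \<longlonglongrightarrow> 0"
  shows "(\<lambda>n. qf (G n)) \<longlonglongrightarrow> qf g"
proof -
  have "qf (G n) = qf g + 2 * ip g (\<lambda>x. G n x - g x) + qf (\<lambda>x. G n x - g x)" for n
    using qf_linear[OF assms(1) dom_diff[OF assms(2,1)], of 1] by simp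
  moreover have "(\<lambda>n. qf g + 2 * ip g (\<lambda>x. G n x - g x) + qf (\<lambda>x. G n x - g x))
      \<longlonglongrightarrow> qf g + 2 * 0 + 0"
    by (intro tendsto_intros ip_diff_tendsto_zero assms)
  ultimately show ?thesis by simp
qed

text \<open>Lower semicontinuity under pointwise convergence: finite partial sums converge and stay
  below the bounds. The bound depends on n because for a minimising sequence only its limit is
  sharp.\<close>

lemma fatou:
  assumes F: "\<And>n. F n \<in> dom" and lim: "\<And>x. (\<lambda>n. F n x) \<longlonglongrightarrow> f x"
    and bound: "\<And>n. qf (F n) \<le> C n" and C: "C \<longlonglongrightarrow> c"
  shows "f \<in> dom" "qf f \<le> c"
proof -
  have fin: "(\<Sum>i\<in>S. w i * (T i f)\<^sup>2) \<le> c" if "finite S" for S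
  proof (rule LIMSEQ_le[OF _ C])
    show "(\<lambda>n. \<Sum>i\<in>S. w i * (T i (F n))\<^sup>2) \<longlonglongrightarrow> (\<Sum>i\<in>S. w i * (T i f)\<^sup>2)"
      by (intro tendsto_intros T_tendsto lim)
    have "(\<Sum>i\<in>S. w i * (T i (F n))\<^sup>2) \<le> qf (F n)" for n
      unfolding qf_eq using F[of n] that
      by (intro finite_sum_le_infsum) (auto simp: dom_def w_nonneg)
    then show "\<exists>N. \<forall>n\<ge>N. (\<Sum>i\<in>S. w i * (T i (F n))\<^sup>2) \<le> C n"
      using bound order_trans by blast
  qed
  show dom: "f \<in> dom"
    unfolding dom_def using fin
    by (auto intro!: nonneg_bdd_above_summable_on bdd_aboveI[of _ c] simp: w_nonneg)
  then show "qf f \<le> c"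
    unfolding qf_eq by (intro infsum_le_finite_sums fin) (simp_all add: dom_def)
qed

end

text \<open>Dominated convergence with majorant \<open>K\<^sup>2 * w i\<close>: off a finite set the
  tail is small uniformly in n, and on that set pointwise convergence suffices.\<close>

lemma dominated_square_sum_tendsto_zero:
  fixes w :: "'i \<Rightarrow> real" and G :: "nat \<Rightarrow> 'i \<Rightarrow> real"
  assumes w: "\<And>i. 0 \<le> w i" "w summable_on UNIV"
    and bound: "\<And>n i. \<bar>G n i\<bar> \<le> K" and lim: "\<And>i. (\<lambda>n. G n i) \<longlonglongrightarrow> 0"
  shows "(\<lambda>n. \<Sum>\<^sub>\<infinity>i. w i * (G n i)\<^sup>2) \<longlonglongrightarrow> 0"
proof (rule LIMSEQ_I)
  fix e :: real assume e: "0 < e"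
  have le: "w i * (G n i)\<^sup>2 \<le> K\<^sup>2 * w i" for n i
  proof -
    have "(G n i)\<^sup>2 \<le> K\<^sup>2" using bound[of n i] by (simp add: abs_le_square_iff[symmetric])
    then show ?thesis using mult_left_mono[OF _ w(1)[of i]] by (metis mult.commute)
  qed
  have summ: "(\<lambda>i. K\<^sup>2 * w i) summable_on UNIV" by (intro summable_on_cmult_right w)
  have summG: "(\<lambda>i. w i * (G n i)\<^sup>2) summable_on UNIV" for n
    by (rule summable_on_comparison_test[OF summ]) (auto simp: le w)
  obtain S where S: "finite S" "dist (\<Sum>i\<in>S. K\<^sup>2 * w i) (\<Sum>\<^sub>\<infinity>i. K\<^sup>2 * w i) \<le> e / 4"
    using infsum_finite_approximation[OF summ, of "e/4"] e by auto
  have "(\<Sum>\<^sub>\<infinity>i. K\<^sup>2 * w i) = (\<Sum>i\<in>S. K\<^sup>2 * w i) + (\<Sum>\<^sub>\<infinity>i\<in>-S. K\<^sup>2 * w i)"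
    using infsum_Un_disjoint[of "\<lambda>i. K\<^sup>2 * w i" S "-S"] S summ
    by (auto intro: summable_on_subset)
  then have tail: "(\<Sum>\<^sub>\<infinity>i\<in>-S. K\<^sup>2 * w i) \<le> e / 4"
    using S(2) by (simp add: dist_real_def)
  have "(\<lambda>n. \<Sum>i\<in>S. w i * (G n i)\<^sup>2) \<longlonglongrightarrow> (\<Sum>i\<in>S. w i * 0\<^sup>2)"
    by (intro tendsto_intros lim)
  then have "\<forall>\<^sub>F n in sequentially. (\<Sum>i\<in>S. w i * (G n i)\<^sup>2) < e / 4"
    using e by (intro order_tendstoD(2)) auto
  then obtain N where N: "\<And>n. n \<ge> N \<Longrightarrow> (\<Sum>i\<in>S. w i * (G n i)\<^sup>2) < e / 4"
    by (auto simp: eventually_sequentially)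
  have "norm ((\<Sum>\<^sub>\<infinity>i. w i * (G n i)\<^sup>2) - 0) < e" if "n \<ge> N" for n
  proof -
    have "(\<Sum>\<^sub>\<infinity>i. w i * (G n i)\<^sup>2)
        = (\<Sum>i\<in>S. w i * (G n i)\<^sup>2) + (\<Sum>\<^sub>\<infinity>i\<in>-S. w i * (G n i)\<^sup>2)"
      using infsum_Un_disjoint[of "\<lambda>i. w i * (G n i)\<^sup>2" S "-S"] S summG[of n]
      by (auto intro: summable_on_subset)
    moreover have "(\<Sum>\<^sub>\<infinity>i\<in>-S. w i * (G n i)\<^sup>2) \<le> (\<Sum>\<^sub>\<infinity>i\<in>-S. K\<^sup>2 * w i)"
      by (intro infsum_mono summable_on_subset[OF summG] summable_on_subset[OF summ]) (auto simp: le)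
    moreover have "0 \<le> (\<Sum>\<^sub>\<infinity>i. w i * (G n i)\<^sup>2)"
      by (intro infsum_nonneg) (simp add: w)
    ultimately show ?thesis using tail N[OF that] e by simp
  qed
  then show "\<exists>N. \<forall>n\<ge>N. norm ((\<Sum>\<^sub>\<infinity>i. w i * (G n i)\<^sup>2) - 0) < e" by blast
qed

subsection \<open>Finitely supported functions and measures of full support\<close>

lemma fin_supp_linear: "f \<in> fin_supp \<Longrightarrow> g \<in> fin_supp \<Longrightarrow> (\<lambda>x. f x + t * g x) \<in> fin_supp"
  unfolding fin_supp_def mem_Collect_eq
  by (rule finite_subset[of _ "{x. f x \<noteq> 0} \<union> {x. g x \<noteq> 0}"]) auto

lemma indicator_in_fin_supp: "(\<lambda>x. if x = a then t else 0) \<in> fin_supp"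
  by (auto simp: fin_supp_def intro: finite_subset[of _ "{a}"])

text \<open>Finite support makes the range finite, so the supremum is taken over a bounded
  set.\<close>

lemma abs_le_sup_norm:
  assumes "f \<in> fin_supp"
  shows "\<bar>f x\<bar> \<le> sup_norm f"
proof -
  have "range (\<lambda>x. \<bar>f x\<bar>) \<subseteq> insert 0 ((\<lambda>x. \<bar>f x\<bar>) ` {x. f x \<noteq> 0})" by auto
  then have "finite (range (\<lambda>x. \<bar>f x\<bar>))"
    using assms by (auto simp: fin_supp_def dest: finite_subset)
  then show ?thesis
    unfolding sup_norm_def by (intro cSUP_upper bdd_above_finite) auto
qed

lemma square_le_sup_norm: "f \<in> fin_supp \<Longrightarrow> (f x)\<^sup>2 \<le> (sup_norm f)\<^sup>2"
  using abs_le_sup_norm[of f x] by (simp add: abs_le_square_iff[symmetric])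

text \<open>The measure is a convex combination of the point mass at x, with weight s, and a law q
  of full support, the image of a geometric law under an enumeration of the vertices.\<close>

lemma ex_full_support_prob:
  assumes "countable (UNIV :: 'a set)" "0 < s" "s < 1"
  obtains m where "m \<in> full_support_prob" "s \<le> measure m {x :: 'a}"
proof -
  define q where "q = map_pmf (from_nat_into (UNIV :: 'a set)) (geometric_pmf (1/2))"
  define p where "p = bind_pmf (bernoulli_pmf s) (\<lambda>c. if c then return_pmf x else q)"
  have q: "set_pmf q = UNIV"
    unfolding q_def set_map_pmf using assms
    by (simp add: set_pmf_geometric range_from_nat_into)
  have pmf: "pmf p y = s * pmf (return_pmf x) y + (1 - s) * pmf q y" for y
    unfolding p_def pmf_bind using assms by simp
  have "0 < pmf p y" for y
    unfolding pmf using assms q pmf_positive[of y q]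
    by (intro add_nonneg_pos mult_pos_pos) auto
  then have "measure_pmf p \<in> full_support_prob"
    by (simp add: full_support_prob_def prob_space_measure_pmf measure_pmf_single)
  moreover have "s \<le> measure (measure_pmf p) {x}"
    using pmf[of x] assms by (simp add: measure_pmf_single)
  ultimately show thesis by (rule that)
qed

subsection \<open>The lowest eigenvalue as an infimum of Rayleigh quotients\<close>

text \<open>One measure and any admissible constant are fixed here; the optimal constant and the
  variation of m enter at the end.\<close>

locale sup_poincare_graph =
  fixes b :: "'a \<Rightarrow> 'a \<Rightarrow> real" and c :: real and m :: "'a measure"
  assumes graph: "weighted_graph b" and fin_supp_energy: "fin_supp \<subseteq> finite_energy b"
    and c_pos: "0 < c" and poincare: "sup_poincare b c" and m: "m \<in> full_support_prob"
begin

text \<open>The index is a pair of vertices, and the factor 1/2 goes into the weight so that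
  \<open>E.ip\<close> is exactly \<open>energy b\<close>.\<close>

sublocale E: square_sum_form "\<lambda>p. b (fst p) (snd p) / 2"
    "\<lambda>p (f :: 'a \<Rightarrow> real). f (fst p) - f (snd p)"
  using graph by unfold_locales (auto simp: weighted_graph_def algebra_simps intro!: tendsto_intros)

sublocale N: square_sum_form "\<lambda>x. measure m {x}" "\<lambda>x (f :: 'a \<Rightarrow> real). f x"
  by unfold_locales auto

lemma energy_eq: "energy b f g = E.ip f g"
  unfolding energy_def E.ip_def
  by (subst infsum_cmult_right'[symmetric]) (simp add: case_prod_unfold mult.assoc)

lemma finite_energy_eq: "finite_energy b = E.dom"
  using summable_on_cmult_right'[of "1/2 :: real" "\<lambda>p. b (fst p) (snd p) * (f (fst p) - f (snd p))\<^sup>2" UNIV for f]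
  by (simp add: finite_energy_def E.dom_def case_prod_unfold)

lemma ell2_inner_eq: "ell2_inner m f g = N.ip f g"
  unfolding ell2_inner_def N.ip_def by (simp add: ac_simps)

lemma ell2_eq: "ell2 m = N.dom"
  unfolding ell2_def N.dom_def by (simp add: ac_simps)

lemma form_norm_square: "(form_norm b m f)\<^sup>2 = E.qf f + N.qf f"
  unfolding form_norm_def energy_eq ell2_inner_eq by (simp add: E.qf_nonneg N.qf_nonneg)

lemma form_norm_nonneg: "0 \<le> form_norm b m f"
  unfolding form_norm_def energy_eq ell2_inner_eq by (simp add: E.qf_nonneg N.qf_nonneg)

section \<open>Comparison of supremum norm, l2 norm and energy\<close>

lemma weight_pos: "0 < measure m {x}"
  using m by (simp add: full_support_prob_def)

lemma sum_weights_le_1: "finite S \<Longrightarrow> (\<Sum>x\<in>S. measure m {x}) \<le> 1"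
proof -
  interpret prob_space m using m by (simp add: full_support_prob_def)
  assume "finite S"
  then have "measure m S = (\<Sum>x\<in>S. measure m {x})"
    using m by (intro finite_measure_eq_sum_singleton) (auto simp: full_support_prob_def)
  then show ?thesis using prob_le_1[of S] by simp
qed

lemma weights_summable: "(\<lambda>x. measure m {x}) summable_on UNIV"
  using sum_weights_le_1
  by (intro nonneg_bdd_above_summable_on) (auto intro!: bdd_aboveI[of _ 1])

text \<open>Since the total mass is at most 1, a uniform bound passes to the l2 norm without loss.
  This turns the supremum inequality into an l2 inequality with the same constant.\<close>

lemma bounded_in_ell2:
  assumes "\<And>x. \<bar>f x\<bar> \<le> K"
  shows "f \<in> N.dom" "N.qf f \<le> K\<^sup>2"
proof -
  have le: "measure m {x} * (f x)\<^sup>2 \<le> K\<^sup>2 * measure m {x}" for x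
  proof -
    have "(f x)\<^sup>2 \<le> K\<^sup>2" using assms[of x] by (simp add: abs_le_square_iff[symmetric])
    then show ?thesis using mult_right_mono[OF _ measure_nonneg] by (metis mult.commute)
  qed
  have summ: "(\<lambda>x. K\<^sup>2 * measure m {x}) summable_on UNIV"
    by (intro summable_on_cmult_right weights_summable)
  then show dom: "f \<in> N.dom"
    unfolding N.dom_def mem_Collect_eq by (rule summable_on_comparison_test) (auto intro: le)
  have "(\<Sum>\<^sub>\<infinity>x. measure m {x}) \<le> 1"
    by (intro infsum_le_finite_sums weights_summable sum_weights_le_1)
  then have "K\<^sup>2 * (\<Sum>\<^sub>\<infinity>x. measure m {x}) \<le> K\<^sup>2 * 1" by (intro mult_left_mono) auto
  moreover have "N.qf f \<le> (\<Sum>\<^sub>\<infinity>x. K\<^sup>2 * measure m {x})"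
    unfolding N.qf_eq using dom by (intro infsum_mono summ le) (simp add: N.dom_def)
  ultimately show "N.qf f \<le> K\<^sup>2" by (simp add: infsum_cmult_right')
qed

lemma fin_supp_dom: "f \<in> fin_supp \<Longrightarrow> f \<in> E.dom" "f \<in> fin_supp \<Longrightarrow> f \<in> N.dom"
  using fin_supp_energy finite_energy_eq bounded_in_ell2(1)[OF abs_le_sup_norm] by auto

lemma sup_norm_le_energy: "f \<in> fin_supp \<Longrightarrow> (sup_norm f)\<^sup>2 \<le> c * E.qf f"
  using poincare by (simp add: sup_poincare_def energy_eq)

lemma N_le_energy: "f \<in> fin_supp \<Longrightarrow> N.qf f \<le> c * E.qf f"
  by (rule order_trans[OF bounded_in_ell2(2)[OF abs_le_sup_norm] sup_norm_le_energy])

text \<open>One term of a nonnegative series. It gives definiteness of the norm and, at a vertex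
  carrying most of the mass, a useful lower bound.\<close>

lemma point_le_N: "f \<in> N.dom \<Longrightarrow> measure m {x} * (f x)\<^sup>2 \<le> N.qf f"
  using finite_sum_le_infsum[of "\<lambda>x. measure m {x} * (f x)\<^sup>2" UNIV "{x}"]
  by (simp add: N.qf_eq N.dom_def)

lemma N_pos:
  assumes "f \<in> N.dom" "f \<noteq> (\<lambda>x. 0)"
  shows "0 < N.qf f"
proof -
  obtain x where "f x \<noteq> 0" using assms by auto
  then have "0 < measure m {x} * (f x)\<^sup>2" using weight_pos by simp
  then show ?thesis using point_le_N[OF assms(1), of x] by simp
qed

section \<open>The form domain through approximating sequences\<close>

definition approximates :: "(nat \<Rightarrow> 'a \<Rightarrow> real) \<Rightarrow> ('a \<Rightarrow> real) \<Rightarrow> bool" where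
  "approximates G f \<longleftrightarrow> range G \<subseteq> fin_supp \<and>
     (\<lambda>n. E.qf (\<lambda>x. G n x - f x)) \<longlonglongrightarrow> 0 \<and> (\<lambda>n. N.qf (\<lambda>x. G n x - f x)) \<longlonglongrightarrow> 0"

lemma approximates_dom: "approximates G f \<Longrightarrow> G n \<in> E.dom" "approximates G f \<Longrightarrow> G n \<in> N.dom"
  unfolding approximates_def by (blast intro: fin_supp_dom)+

text \<open>Closure in the form norm is recast with sequences, along which energy and l2 norm can be
  treated separately.\<close>

lemma form_dom_iff: "f \<in> form_dom b m \<longleftrightarrow> f \<in> E.dom \<and> f \<in> N.dom \<and> (\<exists>G. approximates G f)"
proof (intro iffI conjI; (elim conjE)?)
  assume f: "f \<in> form_dom b m"
  then show "f \<in> E.dom" "f \<in> N.dom" by (auto simp: form_dom_def finite_energy_eq ell2_eq)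
  have "\<exists>g\<in>fin_supp. form_norm b m (\<lambda>x. f x - g x) < inverse (real (Suc n))" for n
    using f by (simp add: form_dom_def)
  then obtain G where G: "\<And>n. G n \<in> fin_supp"
    "\<And>n. form_norm b m (\<lambda>x. f x - G n x) < inverse (real (Suc n))" by metis
  have "(\<lambda>n. form_norm b m (\<lambda>x. f x - G n x)) \<longlonglongrightarrow> 0"
    using G(2) by (intro tendsto_sandwich[OF _ _ tendsto_const LIMSEQ_inverse_real_of_nat])
      (auto intro!: always_eventually form_norm_nonneg less_imp_le)
  then have "(\<lambda>n. (form_norm b m (\<lambda>x. f x - G n x))\<^sup>2) \<longlonglongrightarrow> 0\<^sup>2" by (intro tendsto_power)
  then have lim: "(\<lambda>n. E.qf (\<lambda>x. G n x - f x) + N.qf (\<lambda>x. G n x - f x)) \<longlonglongrightarrow> 0"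
    by (simp add: form_norm_square E.qf_diff_commute N.qf_diff_commute)
  have "(\<lambda>n. E.qf (\<lambda>x. G n x - f x)) \<longlonglongrightarrow> 0"
    by (rule tendsto_sandwich[OF _ _ tendsto_const lim])
      (auto intro!: always_eventually simp: E.qf_nonneg N.qf_nonneg)
  moreover have "(\<lambda>n. N.qf (\<lambda>x. G n x - f x)) \<longlonglongrightarrow> 0"
    by (rule tendsto_sandwich[OF _ _ tendsto_const lim])
      (auto intro!: always_eventually simp: E.qf_nonneg N.qf_nonneg)
  ultimately show "\<exists>G. approximates G f" using G(1) by (auto simp: approximates_def)
next
  assume dom: "f \<in> E.dom" "f \<in> N.dom" and "\<exists>G. approximates G f"
  then obtain G where G: "approximates G f" by blast
  have "(\<lambda>n. sqrt (E.qf (\<lambda>x. G n x - f x) + N.qf (\<lambda>x. G n x - f x))) \<longlonglongrightarrow> sqrt (0 + 0)"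
    using G by (intro tendsto_intros) (auto simp: approximates_def)
  then have lim: "(\<lambda>n. form_norm b m (\<lambda>x. f x - G n x)) \<longlonglongrightarrow> 0"
    by (simp add: form_norm_def energy_eq ell2_inner_eq E.qf_diff_commute N.qf_diff_commute)
  have "\<exists>g\<in>fin_supp. form_norm b m (\<lambda>x. f x - g x) < e" if "0 < e" for e
  proof -
    have "\<forall>\<^sub>F n in sequentially. form_norm b m (\<lambda>x. f x - G n x) < e"
      using order_tendstoD(2)[OF lim that] .
    then obtain n where "form_norm b m (\<lambda>x. f x - G n x) < e"
      by (auto simp: eventually_sequentially)
    then show ?thesis using G by (auto simp: approximates_def)
  qed
  then show "f \<in> form_dom b m" using dom by (auto simp: form_dom_def finite_energy_eq ell2_eq)
qed

lemma fin_supp_form_dom: "f \<in> fin_supp \<Longrightarrow> f \<in> form_dom b m"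
  unfolding form_dom_iff using fin_supp_dom
  by (auto intro!: exI[of _ "\<lambda>n. f"] simp: approximates_def E.ip_def N.ip_def)

text \<open>Needed for the variations f + t h of a minimiser. The error of the combined sequence is
  split by \<open>qf_linear_le\<close>.\<close>

lemma form_dom_linear:
  assumes "f \<in> form_dom b m" "g \<in> form_dom b m"
  shows "(\<lambda>x. f x + t * g x) \<in> form_dom b m"
proof -
  obtain F G where F: "approximates F f" and G: "approximates G g"
    using assms form_dom_iff by blast
  define H where "H n = (\<lambda>x. F n x + t * G n x)" for n
  have diff: "(\<lambda>x. H n x - (f x + t * g x)) = (\<lambda>x. (F n x - f x) + t * (G n x - g x))" for n
    by (auto simp: H_def algebra_simps)
  have dom: "f \<in> E.dom" "g \<in> E.dom" "f \<in> N.dom" "g \<in> N.dom" using assms form_dom_iff by auto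
  have "(\<lambda>n. 2 * E.qf (\<lambda>x. F n x - f x) + 2 * t\<^sup>2 * E.qf (\<lambda>x. G n x - g x)) \<longlonglongrightarrow> 2 * 0 + 2 * t\<^sup>2 * 0"
    "(\<lambda>n. 2 * N.qf (\<lambda>x. F n x - f x) + 2 * t\<^sup>2 * N.qf (\<lambda>x. G n x - g x)) \<longlonglongrightarrow> 2 * 0 + 2 * t\<^sup>2 * 0"
    using F G by (intro tendsto_intros; simp add: approximates_def)+
  then have lim: "(\<lambda>n. 2 * E.qf (\<lambda>x. F n x - f x) + 2 * t\<^sup>2 * E.qf (\<lambda>x. G n x - g x)) \<longlonglongrightarrow> 0"
    "(\<lambda>n. 2 * N.qf (\<lambda>x. F n x - f x) + 2 * t\<^sup>2 * N.qf (\<lambda>x. G n x - g x)) \<longlonglongrightarrow> 0"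
    by simp_all
  have "(\<lambda>n. E.qf (\<lambda>x. H n x - (f x + t * g x))) \<longlonglongrightarrow> 0"
    unfolding diff
    by (rule tendsto_sandwich[OF _ _ tendsto_const lim(1)];
        intro always_eventually allI E.qf_nonneg E.qf_linear_le E.dom_diff
          approximates_dom[OF F] approximates_dom[OF G] dom)
  moreover have "(\<lambda>n. N.qf (\<lambda>x. H n x - (f x + t * g x))) \<longlonglongrightarrow> 0"
    unfolding diff
    by (rule tendsto_sandwich[OF _ _ tendsto_const lim(2)];
        intro always_eventually allI N.qf_nonneg N.qf_linear_le N.dom_diff
          approximates_dom[OF F] approximates_dom[OF G] dom)
  moreover have "range H \<subseteq> fin_supp"
    unfolding H_def using F G by (auto simp: approximates_def intro!: fin_supp_linear)
  ultimately have "approximates H (\<lambda>x. f x + t * g x)" by (simp add: approximates_def)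
  then show ?thesis
    unfolding form_dom_iff using dom by (auto intro!: E.dom_linear N.dom_linear)
qed

section \<open>Rayleigh quotients\<close>

definition rayleigh_inf :: real where
  "rayleigh_inf = (INF f\<in>fin_supp - {\<lambda>x. 0}. E.qf f / N.qf f)"

lemma rayleigh_quotient_ge: "f \<in> fin_supp - {\<lambda>x. 0} \<Longrightarrow> 1 / c \<le> E.qf f / N.qf f"
  using N_le_energy[of f] N_pos[OF fin_supp_dom(2), of f] c_pos by (simp add: field_simps)

lemma fin_supp_nontrivial: "fin_supp - {\<lambda>x. 0} \<noteq> ({} :: ('a \<Rightarrow> real) set)"
proof -
  \<comment> \<open>\<open>undefined\<close> stands for an arbitrary vertex.\<close>
  define d where "d = (\<lambda>x :: 'a. if x = undefined then 1 else 0 :: real)"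
  have "d \<in> fin_supp" unfolding d_def by (rule indicator_in_fin_supp)
  moreover have "d undefined \<noteq> 0" by (simp add: d_def)
  ultimately have "d \<in> fin_supp - {\<lambda>x. 0}" by auto
  then show ?thesis by blast
qed

lemma rayleigh_bdd_below: "bdd_below ((\<lambda>f. E.qf f / N.qf f) ` (fin_supp - {\<lambda>x. 0}))"
  by (rule bdd_belowI2) (rule rayleigh_quotient_ge)

lemma rayleigh_inf_ge: "1 / c \<le> rayleigh_inf"
  unfolding rayleigh_inf_def
  by (intro cINF_greatest fin_supp_nontrivial rayleigh_quotient_ge)

lemma rayleigh_inf_nonneg: "0 \<le> rayleigh_inf"
  using rayleigh_inf_ge c_pos by (smt (verit) zero_le_divide_1_iff)

lemma rayleigh_inf_le:
  assumes "f \<in> fin_supp"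
  shows "rayleigh_inf * N.qf f \<le> E.qf f"
proof (cases "f = (\<lambda>x. 0)")
  case True
  then show ?thesis by (simp add: N.ip_def E.ip_def)
next
  case False
  then have "rayleigh_inf \<le> E.qf f / N.qf f"
    unfolding rayleigh_inf_def using assms
    by (intro cINF_lower rayleigh_bdd_below) auto
  then show ?thesis
    using N_pos[OF fin_supp_dom(2)[OF assms] False] by (simp add: field_simps)
qed

text \<open>Both sides are continuous along an approximating sequence, so the infimum over finitely
  supported functions bounds the quotient on the whole form domain.\<close>

lemma rayleigh_inf_le_form_dom:
  assumes "f \<in> form_dom b m"
  shows "rayleigh_inf * N.qf f \<le> E.qf f"
proof -
  obtain G where G: "approximates G f" and dom: "f \<in> E.dom" "f \<in> N.dom"
    using assms form_dom_iff by auto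
  show ?thesis
  proof (rule LIMSEQ_le)
    show "(\<lambda>n. rayleigh_inf * N.qf (G n)) \<longlonglongrightarrow> rayleigh_inf * N.qf f"
      using G by (intro tendsto_intros N.qf_tendsto approximates_dom[OF G] dom)
        (simp add: approximates_def)
    show "(\<lambda>n. E.qf (G n)) \<longlonglongrightarrow> E.qf f"
      using G by (intro E.qf_tendsto approximates_dom[OF G] dom) (simp add: approximates_def)
    show "\<exists>N. \<forall>n\<ge>N. rayleigh_inf * N.qf (G n) \<le> E.qf (G n)"
      using G by (auto simp: approximates_def intro!: rayleigh_inf_le)
  qed
qed

section \<open>Weak form of the eigenvalue equation\<close>

lemma represents_unique:
  assumes "represents b m f g" "represents b m f h"
  shows "g = h"
proof
  fix a
  \<comment> \<open>Testing against the indicator of a reads off the value at a, up to the positive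
    weight of a.\<close>
  define d where "d = (\<lambda>x :: 'a. if x = a then 1 else 0 :: real)"
  have ip: "N.ip u d = measure m {a} * u a" for u
  proof -
    have "N.ip u d = (\<Sum>\<^sub>\<infinity>x\<in>{a}. measure m {x} * u x * d x)"
      unfolding N.ip_def by (rule infsum_cong_neutral) (auto simp: d_def)
    then show ?thesis by (simp add: d_def)
  qed
  have "d \<in> form_dom b m" unfolding d_def by (intro fin_supp_form_dom indicator_in_fin_supp)
  then have "N.ip g d = N.ip h d"
    using assms by (simp add: represents_def ell2_inner_eq)
  then show "g a = h a" using ip weight_pos[of a] by simp
qed

text \<open>By \<open>represents_unique\<close> the definite description in \<open>laplacian\<close>
  denotes, so the eigenvalue equation can be tested against the form domain.\<close>

lemma laplacian_eigenvalue_iff: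
  "laplacian_eigenvalue b m l \<longleftrightarrow>
     (\<exists>f\<in>form_dom b m. f \<noteq> (\<lambda>x. 0) \<and> (\<forall>h\<in>form_dom b m. E.ip f h = l * N.ip f h))"
proof -
  have "laplacian b m f = g" if "represents b m f g" for f g
    unfolding laplacian_def using that represents_unique by blast
  then have "laplacian_eigenvalue b m l \<longleftrightarrow>
      (\<exists>f\<in>form_dom b m. f \<noteq> (\<lambda>x. 0) \<and> represents b m f (\<lambda>x. l * f x))"
    unfolding laplacian_eigenvalue_def laplacian_dom_def by auto
  moreover have "represents b m f (\<lambda>x. l * f x) \<longleftrightarrow>
      (\<forall>h\<in>form_dom b m. E.ip f h = l * N.ip f h)" if "f \<in> form_dom b m" for f
  proof -
    have "f \<in> N.dom" using that form_dom_iff by blast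
    then have "(\<lambda>x. l * f x) \<in> N.dom"
      using N.dom_linear[of f f "l - 1"] by (simp add: algebra_simps)
    then show ?thesis
      by (simp add: represents_def ell2_eq energy_eq ell2_inner_eq N.ip_scale)
  qed
  ultimately show ?thesis by blast
qed

text \<open>Test the weak equation with the eigenfunction itself.\<close>

lemma eigenvalue_ge_rayleigh_inf:
  assumes "laplacian_eigenvalue b m l"
  shows "rayleigh_inf \<le> l"
proof -
  obtain f where f: "f \<in> form_dom b m" "f \<noteq> (\<lambda>x. 0)" "E.qf f = l * N.qf f"
    using assms laplacian_eigenvalue_iff by blast
  then have "0 < N.qf f" using N_pos form_dom_iff by blast
  then show ?thesis using rayleigh_inf_le_form_dom[OF f(1)] f(3) by simp
qed

section \<open>Existence of a minimiser\<close>

lemma ex_minimizer: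
  obtains f where "f \<in> form_dom b m" "N.qf f = 1" "E.qf f = rayleigh_inf"
proof -
  let ?l = rayleigh_inf
  have "\<exists>f\<in>fin_supp. N.qf f = 1 \<and> E.qf f < ?l + inverse (real (Suc n))" for n
  proof -
    have "?l < ?l + inverse (real (Suc n))" by simp
    then obtain g where g: "g \<in> fin_supp - {\<lambda>x. 0}" "E.qf g / N.qf g < ?l + inverse (real (Suc n))"
      unfolding rayleigh_inf_def cINF_less_iff[OF fin_supp_nontrivial rayleigh_bdd_below] by blast
    have pos: "0 < N.qf g" using g by (intro N_pos fin_supp_dom) auto
    define t where "t = 1 / sqrt (N.qf g)"
    have t: "t\<^sup>2 = 1 / N.qf g" using pos by (simp add: t_def power_divide)
    define f where "f = (\<lambda>x. t * g x)"
    have "f \<in> fin_supp"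
      using g fin_supp_linear[of "\<lambda>x. 0" g t] by (simp add: f_def fin_supp_def)
    moreover have "N.qf f = t\<^sup>2 * N.qf g" "E.qf f = t\<^sup>2 * E.qf g"
      unfolding f_def by (rule N.qf_scale, rule E.qf_scale)
    ultimately show ?thesis using t pos g(2) by (intro bexI[of _ f]) simp_all
  qed
  then have "\<forall>n. \<exists>f. f \<in> fin_supp \<and> N.qf f = 1 \<and> E.qf f < ?l + inverse (real (Suc n))"
    by blast
  from choice[OF this] obtain F0 where F0: "\<And>n. F0 n \<in> fin_supp" "\<And>n. N.qf (F0 n) = 1"
    "\<And>n. E.qf (F0 n) < ?l + inverse (real (Suc n))" by blast
  \<comment> \<open>The energies lie below \<open>?l + 1\<close> because 1/(n+1) <= 1, so the
    supremum inequality bounds all \<open>F0 n\<close> by K.\<close>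
  define K where "K = sqrt (c * (?l + 1))"
  have bound0: "\<bar>F0 n x\<bar> \<le> K" for n x
  proof -
    have "\<bar>F0 n x\<bar>\<^sup>2 \<le> c * E.qf (F0 n)"
      unfolding power2_abs
      by (rule order_trans[OF square_le_sup_norm[OF F0(1)] sup_norm_le_energy[OF F0(1)]])
    also have "\<dots> \<le> c * (?l + 1)"
      using F0(3)[of n] inverse_le_1_iff[of "real (Suc n)"] c_pos by (intro mult_left_mono) simp_all
    finally show ?thesis using c_pos by (simp add: K_def real_le_rsqrt)
  qed
  have "countable (UNIV :: 'a set)" using graph by (simp add: weighted_graph_def)
  \<comment> \<open>Diagonal argument over the countable vertex set.\<close>
  then obtain k where k: "strict_mono (k :: nat \<Rightarrow> nat)"
    and "\<And>x. \<exists>l. (\<lambda>n. F0 (k n) x) \<longlonglongrightarrow> l"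
    using function_convergent_subsequence[of UNIV F0 K] bound0 by auto
  then obtain f where f: "\<And>x. (\<lambda>n. F0 (k n) x) \<longlonglongrightarrow> f x" by metis
  define F where "F n = F0 (k n)" for n
  have F: "F n \<in> fin_supp" "N.qf (F n) = 1" "\<bar>F n x\<bar> \<le> K" for n x
    unfolding F_def using F0 bound0 by auto
  have lim: "(\<lambda>n. F n x) \<longlonglongrightarrow> f x" for x unfolding F_def using f .
  \<comment> \<open>Since \<open>k n\<close> is at least n, the energy bound survives the passage to
    the subsequence.\<close>
  have E_F: "E.qf (F n) \<le> ?l + inverse (real (Suc n))" for n
  proof -
    have "inverse (real (Suc (k n))) \<le> inverse (real (Suc n))"
      using seq_suble[OF k] by (intro le_imp_inverse_le) auto
    then show ?thesis unfolding F_def using F0(3)[of "k n"] by linarith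
  qed
  have dom_F: "F n \<in> E.dom" "F n \<in> N.dom" for n using fin_supp_dom F(1) by auto
  have f_bound: "\<bar>f x\<bar> \<le> K" for x
    by (rule LIMSEQ_le_const2[OF tendsto_rabs[OF lim]]) (simp add: F)
  have f_N: "f \<in> N.dom" using bounded_in_ell2(1)[OF f_bound] .
  have "\<bar>F n x - f x\<bar> \<le> 2 * K" for n x using F(3)[of n x] f_bound[of x] by linarith
  then have N_lim: "(\<lambda>n. N.qf (\<lambda>x. F n x - f x)) \<longlonglongrightarrow> 0"
    unfolding N.qf_eq
    by (rule dominated_square_sum_tendsto_zero[OF measure_nonneg weights_summable])
      (rule LIM_zero[OF lim])
  \<comment> \<open>\<open>a n\<close> is the share of index n in the bound for the energy of F n -
    F j. By the parallelogram identity this energy is at most 4 \<open>?l\<close> + 2/(n+1) +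
    2/(j+1) minus the energy of F n + F j. The latter is at least 4 \<open>?l\<close> minus
    \<open>?l\<close> times the squared l2 norm of F n - F j, which \<open>N.qf_triangle\<close>
    splits through f.\<close>
  define a where "a n = 2 * inverse (real (Suc n)) + 2 * ?l * N.qf (\<lambda>x. F n x - f x)" for n
  have "a \<longlonglongrightarrow> 2 * 0 + 2 * ?l * 0"
    unfolding a_def by (intro tendsto_intros LIMSEQ_inverse_real_of_nat N_lim)
  then have a: "a \<longlonglongrightarrow> 0" by simp
  have cauchy: "E.qf (\<lambda>x. F n x - F j x) \<le> a n + a j" for n j
  proof -
    have "?l * N.qf (\<lambda>x. F n x + F j x) \<le> E.qf (\<lambda>x. F n x + F j x)"
      using fin_supp_linear[OF F(1)[of n] F(1)[of j], of 1] by (intro rayleigh_inf_le) simp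
    moreover have "?l * N.qf (\<lambda>x. F n x + F j x) + ?l * N.qf (\<lambda>x. F n x - F j x) = 4 * ?l"
      using N.parallelogram[OF dom_F(2)[of n] dom_F(2)[of j]] F(2)
      by (simp flip: distrib_left)
    moreover have "?l * N.qf (\<lambda>x. F n x - F j x)
        \<le> ?l * (2 * N.qf (\<lambda>x. F n x - f x) + 2 * N.qf (\<lambda>x. F j x - f x))"
      by (intro mult_left_mono N.qf_triangle dom_F f_N rayleigh_inf_nonneg)
    ultimately show ?thesis
      using E.parallelogram[OF dom_F(1)[of n] dom_F(1)[of j]] E_F[of n] E_F[of j]
      unfolding a_def by (simp add: distrib_left)
  qed
  \<comment> \<open>With n fixed and j tending to infinity, Fatou turns the Cauchy bound into a
    bound for F n - f.\<close>
  have a_shift: "(\<lambda>j. a n + a j) \<longlonglongrightarrow> a n" for n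
    using tendsto_add[OF tendsto_const a] by simp
  have diff: "(\<lambda>x. F n x - f x) \<in> E.dom" "E.qf (\<lambda>x. F n x - f x) \<le> a n" for n
    by (rule E.fatou[OF E.dom_diff[OF dom_F(1) dom_F(1)] tendsto_diff[OF tendsto_const lim] cauchy a_shift])+
  \<comment> \<open>Here f is written as F 0 - (F 0 - f).\<close>
  have f_E: "f \<in> E.dom" using E.dom_diff[OF dom_F(1)[of 0] diff(1)[of 0]] by simp
  have E_lim: "(\<lambda>n. E.qf (\<lambda>x. F n x - f x)) \<longlonglongrightarrow> 0"
    by (rule tendsto_sandwich[OF _ _ tendsto_const a])
      (auto intro!: always_eventually E.qf_nonneg diff)
  have form: "f \<in> form_dom b m"
    unfolding form_dom_iff approximates_def using f_E f_N E_lim N_lim F(1) by blast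
  \<comment> \<open>Strong l2 convergence preserves the normalisation, so the limit is not
    zero.\<close>
  have "(\<lambda>n. N.qf (F n)) \<longlonglongrightarrow> N.qf f" by (intro N.qf_tendsto f_N dom_F N_lim)
  then have N_f: "N.qf f = 1" using F(2) by (simp add: LIMSEQ_const_iff)
  have "E.qf f \<le> ?l + 0"
    by (rule E.fatou(2)[OF dom_F(1) lim E_F]) (intro tendsto_intros LIMSEQ_inverse_real_of_nat)
  moreover have "?l \<le> E.qf f" using rayleigh_inf_le_form_dom[OF form] N_f by simp
  ultimately show thesis using that[OF form N_f] by simp
qed

text \<open>For a minimiser f, the energy of f + t h minus \<open>rayleigh_inf\<close> times its
  squared l2 norm is a nonnegative quadratic polynomial in t that vanishes at t = 0. Its linear
  coefficient is therefore 0, which is the Euler-Lagrange equation.\<close>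

lemma rayleigh_inf_eigenvalue: "laplacian_eigenvalue b m rayleigh_inf"
proof -
  obtain f where f: "f \<in> form_dom b m" "N.qf f = 1" "E.qf f = rayleigh_inf"
    using ex_minimizer .
  have "E.ip f h = rayleigh_inf * N.ip f h" if h: "h \<in> form_dom b m" for h
  proof -
    have dom: "f \<in> E.dom" "f \<in> N.dom" "h \<in> E.dom" "h \<in> N.dom" using f h form_dom_iff by auto
    have "(E.ip f h - rayleigh_inf * N.ip f h)\<^sup>2 \<le> 0 * (E.qf h - rayleigh_inf * N.qf h)"
    proof (rule discriminant_le_if_nonneg)
      fix t
      show "0 \<le> 0 + 2 * t * (E.ip f h - rayleigh_inf * N.ip f h)
          + t\<^sup>2 * (E.qf h - rayleigh_inf * N.qf h)"
        using rayleigh_inf_le_form_dom[OF form_dom_linear[OF f(1) h, of t]]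
          E.qf_linear[OF dom(1,3), of t] N.qf_linear[OF dom(2,4), of t] f
        by (simp add: algebra_simps)
    qed
    then show ?thesis by simp
  qed
  moreover have "f \<noteq> (\<lambda>x. 0)" using f(2) by (auto simp: N.ip_def)
  ultimately show ?thesis unfolding laplacian_eigenvalue_iff using f(1) by blast
qed

lemma lowest_eigenvalue_eq: "lowest_eigenvalue b m = rayleigh_inf"
  unfolding lowest_eigenvalue_def
  by (intro Least_equality rayleigh_inf_eigenvalue eigenvalue_ge_rayleigh_inf)

lemma lowest_eigenvalue_ge: "1 / c \<le> lowest_eigenvalue b m"
  unfolding lowest_eigenvalue_eq by (rule rayleigh_inf_ge)

lemma lowest_eigenvalue_point_le:
  "f \<in> fin_supp \<Longrightarrow> lowest_eigenvalue b m * (measure m {x} * (f x)\<^sup>2) \<le> energy b f f"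
proof -
  assume f: "f \<in> fin_supp"
  show ?thesis
    unfolding lowest_eigenvalue_eq energy_eq
    by (rule order_trans[OF mult_left_mono[OF point_le_N] rayleigh_inf_le])
      (intro fin_supp_dom f rayleigh_inf_nonneg)+
qed

end

subsection \<open>The optimal constant\<close>

lemma energy_nonneg:
  assumes "weighted_graph b"
  shows "0 \<le> energy b f f"
proof -
  have "0 \<le> b x y * (f x - f y) * (f x - f y)" for x y
    using assms by (simp add: weighted_graph_def mult.assoc)
  then show ?thesis unfolding energy_def by (auto intro!: infsum_nonneg)
qed

text \<open>The \<open>LEAST\<close> is attained: the admissible constants are bounded below and
  contain their infimum, because for positive energy the quotient of squared supremum norm and
  energy is a lower bound of all of them.\<close>

lemma poincare_const_least:
  fixes b :: "'a \<Rightarrow> 'a \<Rightarrow> real"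
  assumes graph: "weighted_graph b" and ex: "\<exists>c. sup_poincare b c"
  shows "0 < poincare_const b" "sup_poincare b (poincare_const b)"
    "sup_poincare b c \<Longrightarrow> poincare_const b \<le> c"
proof -
  let ?S = "Collect (sup_poincare b)"
  define d where "d = (\<lambda>x :: 'a. if x = undefined then 1 else 0 :: real)"
  have d: "d \<in> fin_supp" unfolding d_def by (rule indicator_in_fin_supp)
  \<comment> \<open>The indicator of a vertex takes the value 1, so an admissible constant times its
    energy is at least 1.\<close>
  have pos: "0 < c" if "sup_poincare b c" for c
  proof -
    have "1 \<le> c * energy b d d"
      using square_le_sup_norm[OF d, of undefined] that d
      by (fastforce simp: sup_poincare_def d_def intro: order_trans)
    then show ?thesis
      using energy_nonneg[OF graph, of d] by (smt (verit) mult_nonpos_nonneg)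
  qed
  then have bdd: "bdd_below ?S" by (auto intro!: bdd_belowI[of _ 0] less_imp_le)
  have "sup_poincare b (Inf ?S)"
    unfolding sup_poincare_def[of b "Inf ?S"]
  proof
    fix f :: "'a \<Rightarrow> real" assume f: "f \<in> fin_supp"
    show "(sup_norm f)\<^sup>2 \<le> Inf ?S * energy b f f"
    proof (cases "energy b f f = 0")
      \<comment> \<open>At zero energy the inequality says the same for every constant, so any
        admissible one settles it.\<close>
      case True
      then show ?thesis using ex f by (auto simp: sup_poincare_def)
    next
      case False
      then have E: "0 < energy b f f" using energy_nonneg[OF graph, of f] by simp
      have "(sup_norm f)\<^sup>2 / energy b f f \<le> Inf ?S"
        using ex f E by (intro cInf_greatest) (auto simp: sup_poincare_def field_simps)
      then show ?thesis using E by (simp add: field_simps)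
    qed
  qed
  moreover have "Inf ?S \<le> c" if "sup_poincare b c" for c
    using that bdd by (intro cInf_lower) auto
  ultimately have least: "sup_poincare b (Inf ?S)" "\<And>c. sup_poincare b c \<Longrightarrow> Inf ?S \<le> c" by auto
  then have eq: "poincare_const b = Inf ?S"
    unfolding poincare_const_def by (rule Least_equality)
  show "sup_poincare b (poincare_const b)" unfolding eq by (rule least)
  then show "0 < poincare_const b" by (rule pos)
  show "poincare_const b \<le> c" if "sup_poincare b c"
    unfolding eq using that by (rule least)
qed

theorem theorem4p5:
  fixes b :: "'a \<Rightarrow> 'a \<Rightarrow> real"
  assumes "weighted_graph b"
    and "connected_graph b"
    and "infinite (UNIV :: 'a set)"
    and "fin_supp \<subseteq> finite_energy b"
    and "\<exists>c>0. sup_poincare b c"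
  shows "1 / poincare_const b = (INF m\<in>full_support_prob. lowest_eigenvalue b m)"
proof -
  define C where "C = poincare_const b"
  have C: "0 < C" "sup_poincare b C" "\<And>c. sup_poincare b c \<Longrightarrow> C \<le> c"
    unfolding C_def using poincare_const_least[OF assms(1)] assms(5) by blast+
  have loc: "sup_poincare_graph b C m" if "m \<in> full_support_prob" for m
    using assms C that by unfold_locales
  have count: "countable (UNIV :: 'a set)" using assms(1) by (simp add: weighted_graph_def)
  \<comment> \<open>The infimum over measures ranges over a nonempty set.\<close>
  obtain m0 :: "'a measure" where m0: "m0 \<in> full_support_prob"
    using ex_full_support_prob[OF count, of "1/2"] by auto
  define I where "I = (INF m\<in>full_support_prob. lowest_eigenvalue b m)"
  have lower: "1 / C \<le> lowest_eigenvalue b m" if "m \<in> full_support_prob" for m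
    using sup_poincare_graph.lowest_eigenvalue_ge[OF loc[OF that]] .
  have "1 / C \<le> I" unfolding I_def using m0 lower by (intro cINF_greatest) auto
  moreover have "I \<le> 1 / C"
  proof (rule ccontr)
    assume "\<not> I \<le> 1 / C"
    then have IC: "1 < I * C" using C(1) by (simp add: field_simps)
    then have "0 < I" using C(1) by (intro zero_less_mult_pos2[of I C]) simp_all
    \<comment> \<open>Chosen so that I * s^2 * C = 1: one factor s pays for an f that is only nearly
      optimal, the other for the mass s at x.\<close>
    define s where "s = sqrt (1 / (I * C))"
    have s: "0 < s" "s < 1" using IC by (auto simp: s_def)
    have "s * s = 1 / (I * C)" using IC by (simp add: s_def)
    then have ss: "I * (s * (s * C)) = 1" using \<open>0 < I\<close> C(1) by (simp add: field_simps)
    have "\<not> sup_poincare b (s * C)" using C(3)[of "s * C"] s C(1) by auto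
    then obtain f where f: "f \<in> fin_supp" "s * C * energy b f f < (sup_norm f)\<^sup>2"
      by (auto simp: sup_poincare_def not_le)
    \<comment> \<open>The square root puts the strict inequality in terms of the supremum itself, so
      that some vertex x already exceeds the bound.\<close>
    have "sqrt (s * C * energy b f f) < sup_norm f"
      using f abs_le_sup_norm[OF f(1), of undefined] by (intro real_less_lsqrt) auto
    then obtain x where x: "sqrt (s * C * energy b f f) < \<bar>f x\<bar>"
      unfolding sup_norm_def by (subst (asm) less_cSUP_iff) (auto intro!: bdd_aboveI2 abs_le_sup_norm f)
    then have x: "s * C * energy b f f < (f x)\<^sup>2"
      using real_sqrt_less_iff[of "s * C * energy b f f" "(f x)\<^sup>2"] by simp
    obtain m where m: "m \<in> full_support_prob" "s \<le> measure m {x}"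
      using ex_full_support_prob[OF count s] .
    have "I \<le> lowest_eigenvalue b m"
      unfolding I_def using m(1) lower by (intro cINF_lower bdd_belowI2) auto
    \<comment> \<open>Near-optimality of f at x and concentration of m at x combine to make the
      energy of f strictly smaller than itself.\<close>
    have "energy b f f = I * (s * (s * C)) * energy b f f" using ss by simp
    also have "\<dots> = I * (s * (s * C * energy b f f))" by simp
    also have "\<dots> < I * (s * (f x)\<^sup>2)" using x s \<open>0 < I\<close> by simp
    also have "\<dots> \<le> lowest_eigenvalue b m * (measure m {x} * (f x)\<^sup>2)"
      using \<open>I \<le> lowest_eigenvalue b m\<close> \<open>0 < I\<close> m(2) s by (intro mult_mono mult_right_mono) auto
    also have "\<dots> \<le> energy b f f"
      using sup_poincare_graph.lowest_eigenvalue_point_le[OF loc[OF m(1)] f(1)] .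
    finally show False by simp
  qed
  ultimately show ?thesis unfolding C_def I_def by simp
qed

end
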